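(* Let $t$ be an indeterminate, and let $D_n$ ($n\ge 0$) be the shifted derangement numbers. For every integer $n\ge 0$, $$1+\sum_{k=1}^n \frac{t^{k-1}}{(k+1)!} \left((k+1)D_{k-1} +(t-1)D_{k+1}\right) =\frac{t^n}{(n+1)!}D_{n+1}.$$
   Context: The shifted derangement numbers are defined by $D_0=0$, $D_1=1$ and $D_{n+2}=(n+2)D_{n+1}+(n+2)D_n$ for $n\ge 0$; equivalently $D_n=d_{n+1}$, where $d_m$ is the number of permutations of $m$ letters with no fixed points. Empty sums equal $0$. *)

theory Defs
  imports Complex_Main "HOL-Computational_Algebra.Polynomial"
begin

fun shifted_derangement :: "nat \<Rightarrow> nat" where
  "shifted_derangement 0 = 0"
| "shifted_derangement (Suc 0) = 1"
| "shifted_derangement (Suc (Suc n)) =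
     (n + 2) * shifted_derangement (n + 1) + (n + 2) * shifted_derangement n"

end

theory Submission
  imports Defs
begin

text \<open>The sum telescopes. Put \<open>a_k = t^k D_(k+1) / (k+1)!\<close>, so that
  \<open>a_0 = 1\<close>. The recurrence \<open>D_(k+1) = (k+1) (D_k + D_(k-1))\<close> shows that
  the k-th summand is \<open>a_k - a_(k-1)\<close>. Induction on \<open>n\<close> carries this out,
  with \<open>smult_inverse_fact\<close> supplying the common denominator.\<close>

lemma smult_inverse_fact:
  fixes p :: "'a::field_char_0 poly"
  shows "smult (1 / fact n) p = smult (1 / fact (n + 1)) (of_nat (n + 1) * p)"
proof -
  have "smult (1 / fact (n + 1)) (of_nat (n + 1) * p)
      = smult (1 / fact (n + 1) * of_nat (n + 1)) p"
    by (simp add: of_nat_poly del: of_nat_Suc of_nat_add)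
  also have "1 / fact (n + 1) * of_nat (n + 1) = (1 / fact n :: 'a)"
    by (simp add: divide_simps del: of_nat_Suc)
  finally show ?thesis by simp
qed

theorem mainTheorem8:
  fixes n :: nat
  shows "let t = [:0, 1:] :: rat poly; D = shifted_derangement in
    1 + (\<Sum>k = 1..n. smult (1 / fact (k + 1))
           (t ^ (k - 1) * (of_nat (k + 1) * of_nat (D (k - 1)) + (t - 1) * of_nat (D (k + 1)))))
      = smult (1 / fact (n + 1)) (t ^ n * of_nat (D (n + 1)))"
  unfolding Let_def
proof (induction n)
  case 0
  show ?case by simp
next
  case (Suc n)
  let ?t = "[:0, 1:] :: rat poly"
  let ?D = "\<lambda>k. of_nat (shifted_derangement k) :: rat poly"
  have D: "?D (n + 2) = of_nat (n + 2) * ?D (n + 1) + of_nat (n + 2) * ?D n"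
    by (simp only: shifted_derangement.simps(3) add_2_eq_Suc' of_nat_add of_nat_mult)
  have "smult (1 / fact (n + 1)) (?t ^ n * ?D (n + 1))
        + smult (1 / fact (n + 2)) (?t ^ n * (of_nat (n + 2) * ?D n + (?t - 1) * ?D (n + 2)))
      = smult (1 / fact (n + 2)) (of_nat (n + 2) * (?t ^ n * ?D (n + 1))
          + ?t ^ n * (of_nat (n + 2) * ?D n + (?t - 1) * ?D (n + 2)))"
    using smult_inverse_fact[of "n + 1" "?t ^ n * ?D (n + 1)"]
    by (simp only: smult_add_right add.assoc one_add_one)
  \<comment> \<open>By the recurrence, the terms in \<open>?D (n + 1)\<close> and
    \<open>?D n\<close> add up to \<open>?D (n + 2)\<close>, which cancels the -1 in
    \<open>?t - 1\<close>.\<close>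
  also have "of_nat (n + 2) * (?t ^ n * ?D (n + 1))
          + ?t ^ n * (of_nat (n + 2) * ?D n + (?t - 1) * ?D (n + 2))
      = ?t ^ n * (?t * ?D (n + 2))"
    unfolding D by algebra
  also have "\<dots> = ?t ^ (n + 1) * ?D (n + 2)"
    by (simp only: power_add power_one_right mult.assoc)
  finally have step: "smult (1 / fact (n + 1)) (?t ^ n * ?D (n + 1))
        + smult (1 / fact (n + 2)) (?t ^ n * (of_nat (n + 2) * ?D n + (?t - 1) * ?D (n + 2)))
      = smult (1 / fact (n + 2)) (?t ^ (n + 1) * ?D (n + 2))" .
  \<comment> \<open>This bracketing keeps \<open>1 +\<close> attached to the shorter sum, so that
    the left side of the induction hypothesis appears literally.\<close>
  have split_last: "1 + (\<Sum>k = 1..Suc n. f k) = 1 + (\<Sum>k = 1..n. f k) + f (Suc n)"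
    for f :: "nat \<Rightarrow> rat poly"
    by (simp add: add.assoc)
  \<comment> \<open>Indices of the new summand \<open>k = Suc n\<close>; as \<open>k\<close> is
    positive, \<open>k - 1\<close> is never truncated.\<close>
  have "Suc n + 1 = n + 2" "Suc n - 1 = n" by simp_all
  then show ?case
    unfolding split_last Suc.IH using step by (simp only: Suc_eq_plus1)
qed

end
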